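(* Let $U_1=S^6\setminus\{-i\}$ and let $Q\colon U_1\to G_2$, $\xi\mapsto Q_\xi$, be a smooth map with $Q_\xi(i)=\xi$ for all $\xi\in U_1$. For $\xi\in U_1$ put $a=Q_\xi(j)$, $b=Q_\xi(e)$, $c=Q_\xi(g)$, and for $\varphi\in p^{-1}(\xi)$ put $\eta=\varphi(j)$, $\zeta=\varphi(e)$ and $$\theta_\xi(\varphi)=\begin{pmatrix}\langle\eta,a\rangle+I\langle\eta,J_\xi(a)\rangle & \langle\zeta,a\rangle+I\langle\zeta,J_\xi(a)\rangle & \langle\eta\zeta,a\rangle+I\langle\eta\zeta,J_\xi(a)\rangle\\ \langle\eta,b\rangle+I\langle\eta,J_\xi(b)\rangle & \langle\zeta,b\rangle+I\langle\zeta,J_\xi(b)\rangle & \langle\eta\zeta,b\rangle+I\langle\eta\zeta,J_\xi(b)\rangle\\ \langle\eta,c\rangle+I\langle\eta,J_\xi(c)\rangle & \langle\zeta,c\rangle+I\langle\zeta,J_\xi(c)\rangle & \langle\eta\zeta,c\rangle+I\langle\eta\zeta,J_\xi(c)\rangle\end{pmatrix}.$$ Then $\theta_\xi(\varphi)\in\mathrm{SU}(3)$, and $$\psi_1\colon p^{-1}(U_1)\to U_1\times\mathrm{SU}(3),\qquad \varphi\mapsto(\varphi(i),\theta_{\varphi(i)}(\varphi))$$ is a local trivialization over $U_1$ of the principal $\mathrm{SU}(3)$-bundle $p\colon G_2\to S^6$.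
   Context: Octonions: $\mathbb{O}=\mathbb{H}\oplus\mathbb{H}$ with multiplication $(a,b)(u,v)=(au-\bar v b,\ b\bar u+va)$ and conjugation $\overline{(a,b)}=(\bar a,-b)$. A quaternion $a$ is identified with $(a,0)$, and $e=(0,1)$. The real basis $1,i,j,k,e,f=ie,g=je,h=ke$ is orthonormal for the Euclidean inner product $\langle\cdot,\cdot\rangle$ with $|x|^2=x\bar x$. $G_2=\operatorname{Aut}\mathbb{O}$ is the group of real algebra automorphisms of $\mathbb{O}$. $S^6$ is the unit sphere in the space of purely imaginary octonions, and $p\colon G_2\to S^6$, $\varphi\mapsto\varphi(i)$. For $\xi\in S^6$, $V_\xi=T_\xi S^6$ is the space of purely imaginary octonions orthogonal to $\xi$, with complex structure $J_\xi(x)=\xi x$. $I$ denotes the imaginary unit of $\mathbb{C}$, to distinguish it from the octonion $i$. The stabilizer $K=p^{-1}(i)$ acts on $G_2$ on the right by composition, and it is identified with $\mathrm{SU}(3)$ by sending $\Phi\in K$ to the matrix of the complex linear map $\Phi|_{V_i}$ in the complex basis $j,e,g$ of $(V_i,J_i)$; this makes $p$ a principal $\mathrm{SU}(3)$-bundle. A local trivialization over $U_1$ is a diffeomorphism $p^{-1}(U_1)\to U_1\times\mathrm{SU}(3)$ over $U_1$ that is equivariant for the right $\mathrm{SU}(3)$-actions. *)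

theory Defs
  imports "HOL-Analysis.Analysis"
begin

text \<open>
  \<open>(a, b, c, d)\<close> stands for \<open>a + b i + c j + d k\<close>. Since quaternions and octonions are nested
  products of copies of the reals, the library's inner product and norm on them are the Euclidean
  ones, and the coordinate basis (which is \<open>1, i, j, k, e, ie, je, ke\<close>) is orthonormal.
\<close>

type_synonym quat = "real \<times> real \<times> real \<times> real"
type_synonym oct = "quat \<times> quat"

fun qmult :: "quat \<Rightarrow> quat \<Rightarrow> quat" where
  "qmult (a, b, c, d) (a', b', c', d') =
    (a * a' - b * b' - c * c' - d * d',
     a * b' + b * a' + c * d' - d * c',
     a * c' - b * d' + c * a' + d * b',
     a * d' + b * c' - c * b' + d * a')"

fun qconj :: "quat \<Rightarrow> quat" where
  "qconj (a, b, c, d) = (a, - b, - c, - d)"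

fun omult :: "oct \<Rightarrow> oct \<Rightarrow> oct"  (infixl \<open>\<cdot>\<close> 70) where
  "omult (a, b) (u, v) =
    (qmult a u - qmult (qconj v) b, qmult b (qconj u) + qmult v a)"

fun oconj :: "oct \<Rightarrow> oct" where
  "oconj (a, b) = (qconj a, - b)"

definition oct_of_quat :: "quat \<Rightarrow> oct" where
  "oct_of_quat a = (a, 0)"

definition o1 :: oct where "o1 = oct_of_quat (1, 0, 0, 0)"
definition oi :: oct where "oi = oct_of_quat (0, 1, 0, 0)"
definition oj :: oct where "oj = oct_of_quat (0, 0, 1, 0)"
definition oe :: oct where "oe = (0, (1, 0, 0, 0))"
definition og :: oct where "og = oj \<cdot> oe"

lemma omult_oconj_self: "x \<cdot> oconj x = (norm x)\<^sup>2 *\<^sub>R o1"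
proof -
  obtain a b c d a' b' c' d' where x: "x = ((a, b, c, d), (a', b', c', d'))"
    by (metis prod.exhaust_sel)
  show ?thesis
    unfolding power2_norm_eq_inner
    by (simp add: x o1_def oct_of_quat_def zero_prod_def algebra_simps)
qed

definition imaginary :: "oct \<Rightarrow> bool" where
  "imaginary x \<longleftrightarrow> oconj x = - x"

definition S6 :: "oct set" where
  "S6 = {x. imaginary x \<and> norm x = 1}"

definition TS6 :: "oct \<Rightarrow> oct set" where
  "TS6 \<xi> = {x. imaginary x \<and> x \<bullet> \<xi> = 0}"

definition Jmap :: "oct \<Rightarrow> oct \<Rightarrow> oct" where
  "Jmap \<xi> x = \<xi> \<cdot> x"

text \<open>Multiplication by complex scalars on \<open>TS6 \<xi>\<close>, for the complex structure \<open>Jmap \<xi>\<close>.\<close>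

definition cscale :: "oct \<Rightarrow> complex \<Rightarrow> oct \<Rightarrow> oct" where
  "cscale \<xi> z x = Re z *\<^sub>R x + Im z *\<^sub>R Jmap \<xi> x"

text \<open>\<open>C\<^sup>n\<close> on an open set; used only for maps between finite-dimensional spaces.\<close>

fun Ck_on :: "nat \<Rightarrow> ('a::real_normed_vector \<Rightarrow> 'b::real_normed_vector) \<Rightarrow> 'a set \<Rightarrow> bool" where
  "Ck_on 0 f U \<longleftrightarrow> continuous_on U f"
| "Ck_on (Suc n) f U \<longleftrightarrow>
    (\<forall>x\<in>U. f differentiable (at x)) \<and> (\<forall>v. Ck_on n (\<lambda>x. frechet_derivative f (at x) v) U)"

text \<open>
  A map on a subset of a finite-dimensional space is smooth if it extends locally to a smooth map
  on an open set. If the subset is an embedded submanifold, this is smoothness for the submanifold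
  structure. It is applied below to \<open>S6\<close>, to \<open>G2\<close> (a closed subgroup of the linear automorphisms
  of the octonions, in the space of bounded linear endomorphisms), to \<open>SU3\<close>, and to open subsets
  and products of these.
\<close>

definition smooth_map_on :: "'a set \<Rightarrow> ('a::real_normed_vector \<Rightarrow> 'b::real_normed_vector) \<Rightarrow> bool" where
  "smooth_map_on S f \<longleftrightarrow>
    (\<forall>x\<in>S. \<exists>U g. open U \<and> x \<in> U \<and> (\<forall>n. Ck_on n g U) \<and> (\<forall>y\<in>S \<inter> U. g y = f y))"

definition diffeomorphism_betw ::
    "'a set \<Rightarrow> 'b set \<Rightarrow> ('a::real_normed_vector \<Rightarrow> 'b::real_normed_vector) \<Rightarrow> bool" where
  "diffeomorphism_betw S T f \<longleftrightarrow>
    bij_betw f S T \<and> smooth_map_on S f \<and> smooth_map_on T (the_inv_into S f)"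

definition G2 :: "(oct \<Rightarrow>\<^sub>L oct) set" where
  "G2 = {\<phi>. bij (blinfun_apply \<phi>) \<and> (\<forall>x y. \<phi> (x \<cdot> y) = \<phi> x \<cdot> \<phi> y)}"

definition G2_proj :: "(oct \<Rightarrow>\<^sub>L oct) \<Rightarrow> oct" where
  "G2_proj \<phi> = \<phi> oi"

definition G2_over :: "oct set \<Rightarrow> (oct \<Rightarrow>\<^sub>L oct) set" where
  "G2_over U = {\<phi> \<in> G2. G2_proj \<phi> \<in> U}"

definition K_stab :: "(oct \<Rightarrow>\<^sub>L oct) set" where
  "K_stab = G2_over {oi}"

definition conj_transpose :: "complex^'n^'m \<Rightarrow> complex^'m^'n" where
  "conj_transpose A = (\<chi> r s. cnj (A $ s $ r))"

definition SU3 :: "(complex^3^3) set" where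
  "SU3 = {A. A ** conj_transpose A = mat 1 \<and> conj_transpose A ** A = mat 1 \<and> det A = 1}"

text \<open>The complex basis of \<open>TS6 oi\<close>, and the matrix of an element of \<open>K_stab\<close> with respect to it: the
  columns are the coordinates of the images of the basis vectors.\<close>

definition basis_i :: "oct^3" where
  "basis_i = vector [oj, oe, og]"

definition K_matrix :: "(oct \<Rightarrow>\<^sub>L oct) \<Rightarrow> complex^3^3" where
  "K_matrix \<Phi> =
    (THE M. \<forall>s. \<Phi> (basis_i $ s) = (\<Sum>r\<in>UNIV. cscale oi (M $ r $ s) (basis_i $ r)))"

text \<open>The right action of \<open>SU3\<close> on \<open>G2\<close>: composition with the element of \<open>K_stab\<close> that has the given
  matrix.\<close>

definition SU3_act :: "(oct \<Rightarrow>\<^sub>L oct) \<Rightarrow> complex^3^3 \<Rightarrow> (oct \<Rightarrow>\<^sub>L oct)" where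
  "SU3_act \<phi> A = \<phi> o\<^sub>L the_inv_into K_stab K_matrix A"

definition local_trivialization ::
    "oct set \<Rightarrow> ((oct \<Rightarrow>\<^sub>L oct) \<Rightarrow> oct \<times> (complex^3^3)) \<Rightarrow> bool" where
  "local_trivialization U \<psi> \<longleftrightarrow>
    openin (top_of_set S6) U \<and>
    diffeomorphism_betw (G2_over U) (U \<times> SU3) \<psi> \<and>
    (\<forall>\<phi>\<in>G2_over U. fst (\<psi> \<phi>) = G2_proj \<phi>) \<and>
    (\<forall>\<phi>\<in>G2_over U. \<forall>A\<in>SU3. \<psi> (SU3_act \<phi> A) = (fst (\<psi> \<phi>), snd (\<psi> \<phi>) ** A))"

definition U1 :: "oct set" where
  "U1 = S6 - {- oi}"

text \<open>The coefficient \<open>x \<bullet> a + I (x \<bullet> Jmap \<xi> a)\<close>, with \<open>I\<close> the imaginary unit of the complex numbers.\<close>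

definition hcoeff :: "oct \<Rightarrow> oct \<Rightarrow> oct \<Rightarrow> complex" where
  "hcoeff \<xi> x a = Complex (x \<bullet> a) (x \<bullet> Jmap \<xi> a)"

definition theta_mat :: "(oct \<Rightarrow> oct \<Rightarrow>\<^sub>L oct) \<Rightarrow> oct \<Rightarrow> (oct \<Rightarrow>\<^sub>L oct) \<Rightarrow> complex^3^3" where
  "theta_mat Q \<xi> \<phi> =
    (let a = Q \<xi> oj; b = Q \<xi> oe; c = Q \<xi> og; \<eta> = \<phi> oj; \<zeta> = \<phi> oe
     in vector
       [vector [hcoeff \<xi> \<eta> a, hcoeff \<xi> \<zeta> a, hcoeff \<xi> (\<eta> \<cdot> \<zeta>) a],
        vector [hcoeff \<xi> \<eta> b, hcoeff \<xi> \<zeta> b, hcoeff \<xi> (\<eta> \<cdot> \<zeta>) b],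
        vector [hcoeff \<xi> \<eta> c, hcoeff \<xi> \<zeta> c, hcoeff \<xi> (\<eta> \<cdot> \<zeta>) c]])"

definition psi1 :: "(oct \<Rightarrow> oct \<Rightarrow>\<^sub>L oct) \<Rightarrow> (oct \<Rightarrow>\<^sub>L oct) \<Rightarrow> oct \<times> (complex^3^3)" where
  "psi1 Q \<phi> = (G2_proj \<phi>, theta_mat Q (G2_proj \<phi>) \<phi>)"

end

theory Submission
  imports Defs
begin

text \<open>
  Write an octonion as a pair of a complex number and a vector \<open>v\<close> in \<open>\<complex>\<^sup>3\<close>, using the complex basis
  \<open>1\<close> of \<open>\<complex> = span {1, i}\<close> and \<open>j, e, g\<close> of \<open>TS6 oi\<close>. The product then involves only the
  Hermitian form and the conjugated cross product on \<open>\<complex>\<^sup>3\<close>, so the automorphisms fixing \<open>i\<close> are exactly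
  the maps \<open>K_map A: (z, v) \<mapsto> (z, A v)\<close> with \<open>A \<in> SU3\<close>. Since automorphisms are orthogonal,
  \<open>theta_mat Q \<xi> \<phi>\<close> is the matrix of \<open>(Q \<xi>)\<^sup>-\<^sup>1 \<circ> \<phi>\<close>. Hence \<open>psi1 Q\<close> has the inverse
  \<open>(\<xi>, A) \<mapsto> Q \<xi> \<circ> K_map A\<close>, and both maps are polynomial in their argument and in the values of \<open>Q\<close>.
\<close>

section \<open>Smooth maps\<close>

lemma Ck_on_subset: "Ck_on n f U \<Longrightarrow> V \<subseteq> U \<Longrightarrow> Ck_on n f V"
  by (induction n arbitrary: f) (auto intro: continuous_on_subset)

lemma Ck_on_SucD: "Ck_on (Suc n) f U \<Longrightarrow> Ck_on n f U"
proof (induction n arbitrary: f)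
  case 0
  then have "f differentiable_on U"
    by (simp add: differentiable_on_def differentiable_at_withinI)
  then show ?case by (simp add: differentiable_imp_continuous_on)
next
  case (Suc n)
  have "\<forall>x\<in>U. f differentiable (at x)"
    and D: "Ck_on (Suc n) (\<lambda>x. frechet_derivative f (at x) v) U" for v
    using Suc.prems unfolding Ck_on.simps(2)[of "Suc n"] by blast+
  then show ?case using Suc.IH[OF D] by simp
qed

text \<open>Openness makes the two maps agree near each point, so their derivatives agree on
  \<open>U\<close> as well and the induction passes to the next order.\<close>

lemma Ck_on_cong:
  assumes "open U" "\<And>x. x \<in> U \<Longrightarrow> f x = g x" "Ck_on n f U"
  shows "Ck_on n g U"
  using assms(2,3)
proof (induction n arbitrary: f g)
  case 0
  then show ?case by (simp cong: continuous_on_cong)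
next
  case (Suc n)
  have fd: "f differentiable (at x)" if "x \<in> U" for x
    using Suc.prems that by auto
  have gd: "g differentiable (at x)" if "x \<in> U" for x
  proof -
    have "(f has_derivative frechet_derivative f (at x)) (at x)"
      using fd[OF that] by (simp add: frechet_derivative_works)
    then have "(g has_derivative frechet_derivative f (at x)) (at x)"
      by (rule has_derivative_transform_within_open[OF _ assms(1) that Suc.prems(1)])
    then show ?thesis by (auto simp: differentiable_def)
  qed
  have eq: "frechet_derivative f (at x) v = frechet_derivative g (at x) v" if "x \<in> U" for x v
    using frechet_derivative_transform_within_open[OF fd[OF that] assms(1) that Suc.prems(1)] by simp
  have "Ck_on n (\<lambda>x. frechet_derivative g (at x) v) U" for v
    by (rule Suc.IH[where f = "\<lambda>x. frechet_derivative f (at x) v"]) (use eq Suc.prems in auto)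
  then show ?case using gd by simp
qed

text \<open>Admits a closed formula for the derivative: by uniqueness it agrees on \<open>U\<close>
  with the map chosen by \<open>frechet_derivative\<close>.\<close>

lemma Ck_on_SucI:
  assumes "open U" "\<And>x. x \<in> U \<Longrightarrow> (f has_derivative f' x) (at x)"
    "\<And>v. Ck_on n (\<lambda>x. f' x v) U"
  shows "Ck_on (Suc n) f U"
proof -
  have "f' x v = frechet_derivative f (at x) v" if "x \<in> U" for x v
    using frechet_derivative_at[OF assms(2)[OF that]] by simp
  then have "Ck_on n (\<lambda>x. frechet_derivative f (at x) v) U" for v
    by (intro Ck_on_cong[OF assms(1) _ assms(3)])
  then show ?thesis using assms(2) by (auto simp: differentiable_def)
qed

lemma Ck_on_const: "open U \<Longrightarrow> Ck_on n (\<lambda>x. c) U"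
proof (induction n arbitrary: c)
  case 0
  then show ?case by simp
next
  case (Suc n)
  show ?case
    by (rule Ck_on_SucI[where f' = "\<lambda>x v. 0"]) (use Suc in auto)
qed

lemma Ck_on_add: "open U \<Longrightarrow> Ck_on n f U \<Longrightarrow> Ck_on n g U \<Longrightarrow> Ck_on n (\<lambda>x. f x + g x) U"
proof (induction n arbitrary: f g)
  case 0
  then show ?case by (simp add: continuous_on_add)
next
  case (Suc n)
  show ?case
  proof (rule Ck_on_SucI[OF Suc.prems(1)])
    fix x assume "x \<in> U"
    then show "((\<lambda>x. f x + g x) has_derivative
        (\<lambda>v. frechet_derivative f (at x) v + frechet_derivative g (at x) v)) (at x)"
      using Suc.prems by (auto intro!: has_derivative_add simp: frechet_derivative_works[symmetric])
  qed (use Suc in auto)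
qed

text \<open>By the product rule, the derivative is a sum of two terms of the same bilinear shape, so
  the induction closes.\<close>

lemma Ck_on_bounded_bilinear:
  assumes "bounded_bilinear B" "open U"
  shows "Ck_on n f U \<Longrightarrow> Ck_on n g U \<Longrightarrow> Ck_on n (\<lambda>x. B (f x) (g x)) U"
proof (induction n arbitrary: f g)
  case 0
  then show ?case using bounded_bilinear.continuous_on[OF assms(1)] by auto
next
  case (Suc n)
  show ?case
  proof (rule Ck_on_SucI[OF assms(2)])
    fix x assume "x \<in> U"
    then show "((\<lambda>x. B (f x) (g x)) has_derivative
        (\<lambda>v. B (f x) (frechet_derivative g (at x) v) + B (frechet_derivative f (at x) v) (g x))) (at x)"
      using Suc.prems
      by (auto intro!: bounded_bilinear.FDERIV[OF assms(1)] simp: frechet_derivative_works[symmetric])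
  next
    fix v
    \<comment> \<open>Besides their derivatives, \<open>f\<close> and \<open>g\<close> themselves
      occur here, so their order has to be lowered by one.\<close>
    show "Ck_on n (\<lambda>x. B (f x) (frechet_derivative g (at x) v)
        + B (frechet_derivative f (at x) v) (g x)) U"
      using Suc.prems Ck_on_SucD[OF Suc.prems(1)] Ck_on_SucD[OF Suc.prems(2)]
      by (intro Ck_on_add Suc.IH assms) auto
  qed
qed

lemma Ck_on_bounded_linear:
  assumes "bounded_linear L" "open U"
  shows "Ck_on n L U"
proof (cases n)
  case 0
  then show ?thesis using assms by (simp add: linear_continuous_on)
next
  case (Suc m)
  show ?thesis unfolding Suc
    by (rule Ck_on_SucI[where f' = "\<lambda>x. L"])
      (use assms in \<open>auto intro!: bounded_linear_imp_has_derivative Ck_on_const\<close>)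
qed

text \<open>The derivative of the composite along \<open>v\<close> is the derivative of
  \<open>f\<close> along \<open>L v\<close>, again precomposed with \<open>L\<close>.\<close>

lemma Ck_on_compose_bounded_linear:
  assumes "bounded_linear L" "open U"
  shows "Ck_on n f U \<Longrightarrow> Ck_on n (\<lambda>x. f (L x)) (L -` U)"
proof (induction n arbitrary: f)
  case 0
  have "continuous_on (L -` U) L" using assms(1) by (rule linear_continuous_on)
  then show ?case using 0 continuous_on_compose2[of U f "L -` U" L] by auto
next
  case (Suc n)
  show ?case
  proof (rule Ck_on_SucI)
    show "open (L -` U)"
      using assms by (intro open_vimage) (auto simp: linear_continuous_on)
    fix x assume "x \<in> L -` U"
    then show "((\<lambda>x. f (L x)) has_derivative (\<lambda>v. frechet_derivative f (at (L x)) (L v))) (at x)"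
      using Suc.prems
      by (intro has_derivative_compose[OF bounded_linear_imp_has_derivative[OF assms(1)]])
        (auto simp: frechet_derivative_works[symmetric])
  qed (use Suc in auto)
qed

section \<open>Smoothness on arbitrary subsets\<close>

lemma smooth_map_on_cong: "(\<And>x. x \<in> S \<Longrightarrow> f x = g x) \<Longrightarrow> smooth_map_on S f = smooth_map_on S g"
  by (simp add: smooth_map_on_def)

lemma smooth_map_on_const: "smooth_map_on S (\<lambda>x. c)"
  unfolding smooth_map_on_def by (auto intro!: exI[of _ UNIV] exI[of _ "\<lambda>x. c"] Ck_on_const)

lemma smooth_map_on_bounded_linear: "bounded_linear L \<Longrightarrow> smooth_map_on S L"
  unfolding smooth_map_on_def by (auto intro!: exI[of _ UNIV] exI[of _ L] Ck_on_bounded_linear)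

lemma smooth_map_on_bounded_bilinear:
  assumes "bounded_bilinear B" "smooth_map_on S f" "smooth_map_on S g"
  shows "smooth_map_on S (\<lambda>x. B (f x) (g x))"
  unfolding smooth_map_on_def
proof
  fix x assume x: "x \<in> S"
  obtain U f' where U: "open U" "x \<in> U" "\<And>n. Ck_on n f' U" "\<And>y. y \<in> S \<inter> U \<Longrightarrow> f' y = f y"
    using assms(2) x unfolding smooth_map_on_def by metis
  obtain V g' where V: "open V" "x \<in> V" "\<And>n. Ck_on n g' V" "\<And>y. y \<in> S \<inter> V \<Longrightarrow> g' y = g y"
    using assms(3) x unfolding smooth_map_on_def by metis
  have "Ck_on n f' (U \<inter> V)" "Ck_on n g' (U \<inter> V)" for n
    using Ck_on_subset[OF U(3), of "U \<inter> V"] Ck_on_subset[OF V(3), of "U \<inter> V"] by simp_all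
  then have "Ck_on n (\<lambda>y. B (f' y) (g' y)) (U \<inter> V)" for n
    using U(1) V(1) by (intro Ck_on_bounded_bilinear[OF assms(1)]) auto
  then show "\<exists>W h. open W \<and> x \<in> W \<and> (\<forall>n. Ck_on n h W) \<and> (\<forall>y\<in>S \<inter> W. h y = B (f y) (g y))"
    using U V by (intro exI[of _ "U \<inter> V"] exI[of _ "\<lambda>y. B (f' y) (g' y)"]) auto
qed

lemma smooth_map_on_add:
  assumes "smooth_map_on S f" "smooth_map_on S g"
  shows "smooth_map_on S (\<lambda>x. f x + g x)"
  unfolding smooth_map_on_def
proof
  fix x assume x: "x \<in> S"
  obtain U f' where U: "open U" "x \<in> U" "\<And>n. Ck_on n f' U" "\<And>y. y \<in> S \<inter> U \<Longrightarrow> f' y = f y"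
    using assms(1) x unfolding smooth_map_on_def by metis
  obtain V g' where V: "open V" "x \<in> V" "\<And>n. Ck_on n g' V" "\<And>y. y \<in> S \<inter> V \<Longrightarrow> g' y = g y"
    using assms(2) x unfolding smooth_map_on_def by metis
  have "Ck_on n f' (U \<inter> V)" "Ck_on n g' (U \<inter> V)" for n
    using Ck_on_subset[OF U(3), of "U \<inter> V"] Ck_on_subset[OF V(3), of "U \<inter> V"] by simp_all
  then have "Ck_on n (\<lambda>y. f' y + g' y) (U \<inter> V)" for n
    using U(1) V(1) by (intro Ck_on_add) auto
  then show "\<exists>W h. open W \<and> x \<in> W \<and> (\<forall>n. Ck_on n h W) \<and> (\<forall>y\<in>S \<inter> W. h y = f y + g y)"
    using U V by (intro exI[of _ "U \<inter> V"] exI[of _ "\<lambda>y. f' y + g' y"]) auto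
qed

lemma smooth_map_on_sum:
  "(\<And>i. i \<in> I \<Longrightarrow> smooth_map_on S (f i)) \<Longrightarrow> smooth_map_on S (\<lambda>x. \<Sum>i\<in>I. f i x)"
  by (induction I rule: infinite_finite_induct)
    (auto intro: smooth_map_on_const smooth_map_on_add)

lemma smooth_map_on_compose_bounded_linear:
  assumes "bounded_linear L" "smooth_map_on T f" "L ` S \<subseteq> T"
  shows "smooth_map_on S (\<lambda>x. f (L x))"
  unfolding smooth_map_on_def
proof
  fix x assume x: "x \<in> S"
  then have "L x \<in> T" using assms(3) by auto
  then obtain U f' where U: "open U" "L x \<in> U" "\<And>n. Ck_on n f' U" "\<And>y. y \<in> T \<inter> U \<Longrightarrow> f' y = f y"
    using assms(2) unfolding smooth_map_on_def by metis
  have "open (L -` U)"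
    using assms(1) U(1) by (intro open_vimage) (auto simp: linear_continuous_on)
  then show "\<exists>W h. open W \<and> x \<in> W \<and> (\<forall>n. Ck_on n h W) \<and> (\<forall>y\<in>S \<inter> W. h y = f (L y))"
    using U assms(3) Ck_on_compose_bounded_linear[OF assms(1) U(1,3)]
    by (intro exI[of _ "L -` U"] exI[of _ "\<lambda>y. f' (L y)"]) auto
qed

lemma smooth_map_on_linear_image:
  assumes "bounded_linear L" "smooth_map_on S f"
  shows "smooth_map_on S (\<lambda>x. L (f x))"
proof -
  \<comment> \<open>A linear map is treated as a bilinear one whose scalar argument is then held at
    1.\<close>
  have "bounded_bilinear (\<lambda>(r::real) y. r *\<^sub>R L y)"
    by (rule bounded_bilinear.comp[OF bounded_bilinear_scaleR bounded_linear_ident assms(1)])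
  from smooth_map_on_bounded_bilinear[OF this smooth_map_on_const[of S 1] assms(2)]
  show ?thesis by simp
qed

lemma smooth_map_on_Pair:
  assumes "smooth_map_on S f" "smooth_map_on S g"
  shows "smooth_map_on S (\<lambda>x. (f x, g x))"
proof -
  have "smooth_map_on S (\<lambda>x. (f x, 0))" "smooth_map_on S (\<lambda>x. (0, g x))"
    by (rule smooth_map_on_linear_image[OF _ assms(1)] smooth_map_on_linear_image[OF _ assms(2)],
        intro bounded_linear_Pair bounded_linear_ident bounded_linear_zero)+
  from smooth_map_on_add[OF this] show ?thesis by simp
qed

lemma smooth_map_on_Complex:
  assumes "smooth_map_on S f" "smooth_map_on S g"
  shows "smooth_map_on S (\<lambda>x. Complex (f x) (g x))"
proof -
  have "smooth_map_on S (\<lambda>x. f x *\<^sub>R 1 + g x *\<^sub>R \<i>)"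
    by (intro smooth_map_on_add smooth_map_on_bounded_bilinear[OF bounded_bilinear_scaleR]
        assms smooth_map_on_const)
  moreover have "f x *\<^sub>R 1 + g x *\<^sub>R \<i> = Complex (f x) (g x)" for x
    by (simp add: complex_eq_iff)
  ultimately show ?thesis by simp
qed

lemma bounded_linear_axis: "bounded_linear (axis i :: 'a::real_normed_vector \<Rightarrow> 'a^'n)"
  by (rule bounded_linear_intro[where K = 1])
    (auto simp: vec_eq_iff axis_def norm_vec_def L2_set_def if_distrib[of norm] if_distrib[of "\<lambda>t. t^2"] cong: if_cong)

lemma smooth_map_on_vec_nth:
  fixes f :: "'a::real_normed_vector \<Rightarrow> 'b::real_normed_vector^'n"
  assumes "\<And>i. smooth_map_on S (\<lambda>x. f x $ i)"
  shows "smooth_map_on S f"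
proof -
  have "smooth_map_on S (\<lambda>x. \<Sum>i\<in>UNIV. axis i (f x $ i))"
    by (intro smooth_map_on_sum smooth_map_on_linear_image[OF bounded_linear_axis] assms)
  moreover have "(\<Sum>i\<in>UNIV. axis i (f x $ i)) = f x" for x
    by (simp add: vec_eq_iff axis_def)
  ultimately show ?thesis by simp
qed

section \<open>Complex coordinates on the octonions\<close>

text \<open>
  Coordinates with respect to the complex basis \<open>j, e, g\<close> of \<open>TS6 oi\<close>; the last sign is due to
  \<open>i g = - h\<close>.
\<close>

definition octv :: "complex \<Rightarrow> complex^3 \<Rightarrow> oct" where
  "octv z v = ((Re z, Im z, Re (v $ 1), Im (v $ 1)), (Re (v $ 2), Im (v $ 2), Re (v $ 3), - Im (v $ 3)))"

fun cpart :: "oct \<Rightarrow> complex" where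
  "cpart ((a, b, c, d), (a', b', c', d')) = Complex a b"

fun vpart :: "oct \<Rightarrow> complex^3" where
  "vpart ((a, b, c, d), (a', b', c', d')) = vector [Complex c d, Complex a' b', Complex c' (- d')]"

definition herm :: "complex^3 \<Rightarrow> complex^3 \<Rightarrow> complex" where
  "herm v u = (\<Sum>r\<in>UNIV. v $ r * cnj (u $ r))"

text \<open>The complex conjugate of the usual cross product. The conjugation is what makes it
  commute with special unitary matrices.\<close>

definition ccross :: "complex^3 \<Rightarrow> complex^3 \<Rightarrow> complex^3" where
  "ccross v u = vector [cnj (v $ 2 * u $ 3 - v $ 3 * u $ 2), cnj (v $ 3 * u $ 1 - v $ 1 * u $ 3),
    cnj (v $ 1 * u $ 2 - v $ 2 * u $ 1)]"

lemma cpart_octv [simp]: "cpart (octv z v) = z"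
  by (simp add: octv_def)

lemma vpart_octv [simp]: "vpart (octv z v) = v"
  by (simp add: octv_def vec_eq_iff forall_3)

lemma octv_parts [simp]: "octv (cpart x) (vpart x) = x"
  by (cases x rule: cpart.cases) (simp add: octv_def)

lemma oct_cases: obtains z v where "x = octv z v"
  using octv_parts by metis

lemma octv_eq_iff [simp]: "octv z v = octv w u \<longleftrightarrow> z = w \<and> v = u"
  using cpart_octv vpart_octv by metis

lemma octv_add: "octv z v + octv w u = octv (z + w) (v + u)"
  by (simp add: octv_def)

lemma octv_scaleR: "r *\<^sub>R octv z v = octv (r *\<^sub>R z) (r *\<^sub>R v)"
  by (simp add: octv_def)

lemma octv_zero: "octv 0 0 = 0"
  by (simp add: octv_def zero_prod_def)

lemma octv_sum: "(\<Sum>i\<in>I. octv 0 (f i)) = octv 0 (\<Sum>i\<in>I. f i)"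
  by (induction I rule: infinite_finite_induct) (auto simp: octv_zero octv_add)

lemma cpart_add: "cpart (x + y) = cpart x + cpart y"
  by (cases x rule: oct_cases; cases y rule: oct_cases) (simp add: octv_add)

lemma cpart_scaleR: "cpart (r *\<^sub>R x) = r *\<^sub>R cpart x"
  by (cases x rule: oct_cases) (simp add: octv_scaleR)

lemma vpart_add: "vpart (x + y) = vpart x + vpart y"
  by (cases x rule: oct_cases; cases y rule: oct_cases) (simp add: octv_add)

lemma vpart_scaleR: "vpart (r *\<^sub>R x) = r *\<^sub>R vpart x"
  by (cases x rule: oct_cases) (simp add: octv_scaleR)

text \<open>Comparison of the eight real coordinates. The factor \<open>cnj w\<close> reflects that
  \<open>oi\<close> anticommutes with every \<open>octv 0 v\<close>.\<close>

lemma omult_octv: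
  "octv z v \<cdot> octv w u = octv (z * w - herm v u) (z *s u + cnj w *s v + ccross v u)"
  by (simp add: octv_def herm_def ccross_def sum_3 algebra_simps)

lemma inner_octv: "octv z v \<bullet> octv w u = Re (z * cnj w + herm v u)"
  by (simp add: octv_def herm_def sum_3 algebra_simps)

lemma o1_octv: "o1 = octv 1 0"
  by (simp add: o1_def oct_of_quat_def octv_def zero_prod_def)

lemma oi_octv: "oi = octv \<i> 0"
  by (simp add: oi_def oct_of_quat_def octv_def zero_prod_def)

lemma basis_i_octv: "basis_i $ s = octv 0 (axis s 1)"
proof -
  have "\<forall>s. basis_i $ s = octv 0 (axis s 1)"
    by (simp add: forall_3 basis_i_def oj_def oe_def og_def oct_of_quat_def octv_def zero_prod_def axis_def)
  then show ?thesis by blast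
qed

lemma basis_i_simps: "basis_i $ 1 = oj" "basis_i $ 2 = oe" "basis_i $ 3 = og"
  by (simp_all add: basis_i_def)

lemma herm_zero [simp]: "herm 0 u = 0" "herm v 0 = 0"
  by (simp_all add: herm_def)

lemma ccross_zero [simp]: "ccross 0 u = 0" "ccross v 0 = 0"
  by (simp_all add: ccross_def vec_eq_iff forall_3)

lemma Jmap_oi_octv: "Jmap oi (octv z v) = octv (\<i> * z) (\<i> *s v)"
  by (simp add: Jmap_def oi_octv omult_octv)

lemma cscale_oi_octv: "cscale oi c (octv 0 v) = octv 0 (c *s v)"
  by (simp add: cscale_def Jmap_oi_octv octv_scaleR octv_add vec_eq_iff)
    (simp add: complex_eq_iff)

text \<open>As \<open>herm\<close> is conjugate linear in its second argument, pairing with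
  \<open>\<i> *s axis r 1\<close> yields the real part of \<open>- \<i> * v $ r\<close>, which is
  the imaginary part of \<open>v $ r\<close>.\<close>

lemma hcoeff_oi_basis: "hcoeff oi x (basis_i $ r) = vpart x $ r"
proof (cases x rule: oct_cases)
  case (1 z v)
  have "herm v (axis r 1) = v $ r" "herm v (\<i> *s axis r 1) = - \<i> * v $ r"
    by (simp_all add: herm_def axis_def if_distrib[of cnj] if_distrib[of "(*) _"] cong: if_cong)
  then show ?thesis
    by (simp add: 1 hcoeff_def basis_i_octv Jmap_oi_octv inner_octv complex_eq_iff)
qed

section \<open>Automorphisms are orthogonal\<close>

lemma bounded_bilinear_omult: "bounded_bilinear omult"
proof -
  have "linear (\<lambda>y. x \<cdot> y)" for x
  proof
    show "x \<cdot> (y + y') = x \<cdot> y + x \<cdot> y'" for y y'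
      by (cases x rule: cpart.cases; cases y rule: cpart.cases; cases y' rule: cpart.cases)
        (simp add: algebra_simps)
    show "x \<cdot> (r *\<^sub>R y) = r *\<^sub>R (x \<cdot> y)" for r y
      by (cases x rule: cpart.cases; cases y rule: cpart.cases) (simp add: algebra_simps)
  qed
  moreover have "linear (\<lambda>x. x \<cdot> y)" for y
  proof
    show "(x + x') \<cdot> y = x \<cdot> y + x' \<cdot> y" for x x'
      by (cases x rule: cpart.cases; cases y rule: cpart.cases; cases x' rule: cpart.cases)
        (simp add: algebra_simps)
    show "(r *\<^sub>R x) \<cdot> y = r *\<^sub>R (x \<cdot> y)" for r x
      by (cases x rule: cpart.cases; cases y rule: cpart.cases) (simp add: algebra_simps)
  qed
  ultimately show ?thesis
    by (simp add: bilinear_conv_bounded_bilinear[symmetric] bilinear_def)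
qed

lemma omult_o1 [simp]: "x \<cdot> o1 = x" "o1 \<cdot> x = x"
  by (cases x rule: oct_cases; simp add: o1_octv omult_octv)+

text \<open>The octonionic Cayley-Hamilton equation, with trace \<open>2 * Re (cpart x)\<close>. It
  ties the norm to the algebra structure, which automorphisms preserve.\<close>

lemma omult_self: "x \<cdot> x = (2 * Re (cpart x)) *\<^sub>R x - (norm x)\<^sup>2 *\<^sub>R o1"
  unfolding power2_norm_eq_inner
  by (cases x rule: cpart.cases) (simp add: o1_def oct_of_quat_def zero_prod_def algebra_simps)

lemma G2_mult: "\<phi> \<in> G2 \<Longrightarrow> blinfun_apply \<phi> (x \<cdot> y) = \<phi> x \<cdot> \<phi> y"
  unfolding G2_def by blast

lemma G2_bij: "\<phi> \<in> G2 \<Longrightarrow> bij (blinfun_apply \<phi>)"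
  unfolding G2_def by blast

lemma G2I:
  "bij (blinfun_apply \<phi>) \<Longrightarrow> (\<And>x y. blinfun_apply \<phi> (x \<cdot> y) = \<phi> x \<cdot> \<phi> y) \<Longrightarrow> \<phi> \<in> G2"
  unfolding G2_def by blast

lemma G2_o1:
  assumes "\<phi> \<in> G2"
  shows "blinfun_apply \<phi> o1 = o1"
proof -
  obtain x where "\<phi> x = o1"
    using G2_bij[OF assms] by (metis bij_pointE)
  \<comment> \<open>Both sides of the multiplicativity equation are evaluated with
    \<open>\<phi> x = o1\<close>; the right one becomes \<open>\<phi> o1\<close>.\<close>
  then show ?thesis using G2_mult[OF assms, of o1 x] by simp
qed

text \<open>The image under \<open>\<phi>\<close> of the quadratic equation of \<open>x\<close> is
  compared with the quadratic equation of \<open>\<phi> x\<close>. Equal real parts give equal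
  norms; otherwise \<open>\<phi> x\<close> is a real multiple of \<open>o1\<close>, and so is
  \<open>x\<close> by injectivity.\<close>

lemma G2_norm:
  assumes "\<phi> \<in> G2"
  shows "norm (blinfun_apply \<phi> x) = norm x"
proof (cases "Re (cpart x) = Re (cpart (\<phi> x))")
  case True
  have "\<phi> x \<cdot> \<phi> x = \<phi> (x \<cdot> x)" by (simp add: G2_mult assms)
  also have "\<dots> = (2 * Re (cpart x)) *\<^sub>R \<phi> x - (norm x)\<^sup>2 *\<^sub>R o1"
    by (subst omult_self) (simp add: blinfun.bilinear_simps G2_o1 assms)
  finally have "(norm (\<phi> x))\<^sup>2 *\<^sub>R o1 = (norm x)\<^sup>2 *\<^sub>R o1"
    using True omult_self[of "\<phi> x"] by simp
  moreover have "o1 \<noteq> 0" by (simp add: o1_octv octv_zero[symmetric])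
  ultimately show ?thesis by simp
next
  case False
  \<comment> \<open>Subtracting the two quadratic equations leaves
    \<open>d *\<^sub>R \<phi> x\<close> on one side and a multiple of \<open>o1\<close> on the
    other; \<open>t\<close> is the quotient.\<close>
  define d where "d = 2 * Re (cpart (\<phi> x)) - 2 * Re (cpart x)"
  define t where "t = ((norm (\<phi> x))\<^sup>2 - (norm x)\<^sup>2) / d"
  have "\<phi> x \<cdot> \<phi> x = \<phi> (x \<cdot> x)" by (simp add: G2_mult assms)
  also have "\<dots> = (2 * Re (cpart x)) *\<^sub>R \<phi> x - (norm x)\<^sup>2 *\<^sub>R o1"
    by (subst omult_self) (simp add: blinfun.bilinear_simps G2_o1 assms)
  finally have "d *\<^sub>R \<phi> x = ((norm (\<phi> x))\<^sup>2 - (norm x)\<^sup>2) *\<^sub>R o1"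
    using omult_self[of "\<phi> x"] by (simp add: d_def algebra_simps)
  moreover have "d \<noteq> 0" using False by (simp add: d_def)
  ultimately have "\<phi> x = t *\<^sub>R o1"
    by (simp add: t_def divideR_right divide_inverse_commute flip: scaleR_scaleR)
  also have "\<dots> = \<phi> (t *\<^sub>R o1)" by (simp add: blinfun.bilinear_simps G2_o1 assms)
  finally have "x = t *\<^sub>R o1"
    using G2_bij[OF assms] by (metis bij_is_inj injD)
  then show ?thesis by (simp add: blinfun.bilinear_simps G2_o1 assms)
qed

lemma G2_inner:
  assumes "\<phi> \<in> G2"
  shows "blinfun_apply \<phi> x \<bullet> \<phi> y = x \<bullet> y"
  unfolding dot_norm by (simp add: G2_norm assms flip: blinfun.add_right)

text \<open>An automorphism is isometric and intertwines \<open>Jmap \<xi>\<close> with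
  \<open>Jmap (\<phi> \<xi>)\<close>. This carries coefficients at an arbitrary point of the sphere
  back to \<open>oi\<close>.\<close>

lemma G2_hcoeff:
  assumes "\<phi> \<in> G2"
  shows "hcoeff (blinfun_apply \<phi> \<xi>) (\<phi> x) (\<phi> a) = hcoeff \<xi> x a"
  by (simp add: hcoeff_def Jmap_def G2_inner assms flip: G2_mult)

lemma G2_comp:
  assumes "\<phi> \<in> G2" "\<rho> \<in> G2"
  shows "\<phi> o\<^sub>L \<rho> \<in> G2"
proof -
  have "blinfun_apply (\<phi> o\<^sub>L \<rho>) = blinfun_apply \<phi> \<circ> blinfun_apply \<rho>" by auto
  then show ?thesis using assms by (intro G2I) (simp_all add: G2_mult G2_bij bij_comp)
qed

lemma G2_inverse:
  assumes "\<phi> \<in> G2"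
  obtains \<rho> where "\<rho> \<in> G2" "\<And>x. blinfun_apply \<rho> (\<phi> x) = x" "\<And>x. blinfun_apply \<phi> (\<rho> x) = x"
proof -
  let ?g = "inv (blinfun_apply \<phi>)"
  have b: "bij (blinfun_apply \<phi>)" by (rule G2_bij[OF assms])
  have l: "?g (\<phi> x) = x" for x using b by (simp add: bij_is_inj)
  have r: "\<phi> (?g x) = x" for x using b by (simp add: bij_is_surj surj_f_inv_f)
  have "linear ?g"
  proof
    show "?g (x + y) = ?g x + ?g y" for x y
      using l[of "?g x + ?g y"] by (simp add: blinfun.add_right r)
    show "?g (c *\<^sub>R x) = c *\<^sub>R ?g x" for c x
      using l[of "c *\<^sub>R ?g x"] by (simp add: blinfun.scaleR_right r)
  qed
  \<comment> \<open>\<open>Blinfun\<close> represents its argument only if that is bounded linear;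
    boundedness is automatic in finite dimension.\<close>
  then have e: "blinfun_apply (Blinfun ?g) = ?g"
    by (simp add: bounded_linear_Blinfun_apply linear_conv_bounded_linear)
  have "?g (x \<cdot> y) = ?g x \<cdot> ?g y" for x y
    using l[of "?g x \<cdot> ?g y"] by (simp add: G2_mult assms r)
  then have "Blinfun ?g \<in> G2" using b by (intro G2I) (simp_all only: e bij_imp_bij_inv)
  then show thesis using that e l r by metis
qed

section \<open>The stabilizer and the special unitary group\<close>

lemma herm_adjoint: "herm (A *v v) u = herm v (conj_transpose A *v u)"
  by (simp add: herm_def conj_transpose_def matrix_vector_mult_def sum_3 algebra_simps)

text \<open>The cofactor identity for the transpose of \<open>A\<close>, conjugated.\<close>

lemma ccross_conj_transpose:
  "conj_transpose A *v ccross (A *v v) (A *v u) = cnj (det A) *s ccross v u"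
  by (simp add: vec_eq_iff forall_3 ccross_def conj_transpose_def matrix_vector_mult_def sum_3 det_3)
    (simp add: algebra_simps)

lemma SU3_herm:
  assumes "A \<in> SU3"
  shows "herm (A *v v) (A *v u) = herm v u"
  using assms by (simp add: herm_adjoint matrix_vector_mul_assoc SU3_def)

text \<open>Apply \<open>A\<close> to the cofactor identity with determinant 1, and cancel
  \<open>A ** conj_transpose A\<close>.\<close>

lemma SU3_ccross:
  assumes "A \<in> SU3"
  shows "ccross (A *v v) (A *v u) = A *v ccross v u"
proof -
  have "A *v (conj_transpose A *v ccross (A *v v) (A *v u)) = A *v ccross v u"
    using assms by (subst ccross_conj_transpose) (simp add: SU3_def)
  then show ?thesis using assms by (simp add: matrix_vector_mul_assoc SU3_def)
qed

lemma conj_transpose_mult: "conj_transpose (A ** B) = conj_transpose B ** conj_transpose A"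
  by (simp add: conj_transpose_def matrix_matrix_mult_def vec_eq_iff mult.commute)

lemma SU3_mult:
  assumes "A \<in> SU3" "B \<in> SU3"
  shows "A ** B \<in> SU3"
proof -
  have "A ** B ** (conj_transpose B ** conj_transpose A)
      = A ** (B ** conj_transpose B) ** conj_transpose A"
    "conj_transpose B ** conj_transpose A ** (A ** B)
      = conj_transpose B ** (conj_transpose A ** A) ** B"
    by (simp_all only: matrix_mul_assoc)
  then show ?thesis using assms by (simp add: SU3_def conj_transpose_mult det_mul)
qed

section \<open>Automorphisms coming from special unitary matrices\<close>

definition K_map :: "complex^3^3 \<Rightarrow> oct \<Rightarrow>\<^sub>L oct" where
  "K_map A = Blinfun (\<lambda>x. octv (cpart x) (A *v vpart x))"

lemma K_map_apply: "K_map A x = octv (cpart x) (A *v vpart x)"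
proof -
  have "linear (\<lambda>x. octv (cpart x) (A *v vpart x))"
  proof
    show "octv (cpart (x + y)) (A *v vpart (x + y))
        = octv (cpart x) (A *v vpart x) + octv (cpart y) (A *v vpart y)" for x y
      by (simp add: cpart_add vpart_add octv_add matrix_vector_right_distrib)
    show "octv (cpart (c *\<^sub>R x)) (A *v vpart (c *\<^sub>R x)) = c *\<^sub>R octv (cpart x) (A *v vpart x)" for c x
      by (simp add: cpart_scaleR vpart_scaleR octv_scaleR)
        (simp add: vec_eq_iff matrix_vector_mult_def scaleR_sum_right)
  qed
  then show ?thesis
    by (simp add: K_map_def bounded_linear_Blinfun_apply linear_conv_bounded_linear)
qed

lemma K_map_octv [simp]: "K_map A (octv z v) = octv z (A *v v)"
  by (simp add: K_map_apply)

lemma K_map_oi: "K_map A oi = oi"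
  by (simp add: oi_octv)

lemma K_map_basis: "K_map A (basis_i $ s) = octv 0 (column s A)"
  by (simp add: basis_i_octv matrix_vector_mult_def column_def axis_def if_distrib[of "(*) _"]
      cong: if_cong)

lemma K_map_mult: "K_map (A ** B) = K_map A o\<^sub>L K_map B"
  by (rule blinfun_eqI) (simp add: K_map_apply matrix_vector_mul_assoc)

text \<open>Every term of \<open>omult_octv\<close> is compatible with \<open>A\<close>: scalar
  multiples by linearity, \<open>herm\<close> by unitarity, \<open>ccross\<close> by unitarity and
  determinant 1. The adjoint matrix supplies the inverse.\<close>

lemma K_map_in_G2:
  assumes "A \<in> SU3"
  shows "K_map A \<in> G2"
proof -
  have "bij (blinfun_apply (K_map A))"
    using assms
    by (intro o_bij[where g = "blinfun_apply (K_map (conj_transpose A))"])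
      (auto simp: fun_eq_iff K_map_apply matrix_vector_mul_assoc SU3_def)
  moreover have "K_map A (x \<cdot> y) = K_map A x \<cdot> K_map A y" for x y
    by (cases x rule: oct_cases; cases y rule: oct_cases)
      (simp add: omult_octv SU3_herm SU3_ccross assms matrix_vector_right_distrib
        vector_scalar_commute)
  ultimately show ?thesis by (rule G2I)
qed

lemma K_map_in_K_stab: "A \<in> SU3 \<Longrightarrow> K_map A \<in> K_stab"
  by (simp add: K_stab_def G2_over_def G2_proj_def K_map_in_G2 K_map_oi)

text \<open>\<open>{octv 0 v}\<close> consists of the octonions anticommuting with \<open>oi\<close>, hence \<open>K_stab\<close> preserves it.\<close>

lemma K_stab_eq_K_map:
  assumes "\<Phi> \<in> K_stab"
  obtains A where "A \<in> SU3" "\<Phi> = K_map A"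
proof -
  have G: "\<Phi> \<in> G2" and \<Phi>i: "\<Phi> oi = oi"
    using assms by (auto simp: K_stab_def G2_over_def G2_proj_def)
  define T where "T v = vpart (\<Phi> (octv 0 v))" for v
  have \<Phi>v: "\<Phi> (octv 0 v) = octv 0 (T v)" for v
  proof -
    obtain z u where zu: "\<Phi> (octv 0 v) = octv z u" by (rule oct_cases)
    have "octv 0 v \<cdot> oi = (-1) *\<^sub>R (oi \<cdot> octv 0 v)"
      unfolding oi_octv omult_octv octv_scaleR by (simp add: vec_eq_iff)
    then have "octv z u \<cdot> oi = (-1) *\<^sub>R (oi \<cdot> octv z u)"
      using G2_mult[OF G, of "octv 0 v" oi] G2_mult[OF G, of oi "octv 0 v"]
      by (simp add: zu \<Phi>i blinfun.bilinear_simps)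
    \<comment> \<open>The complex component of the anticommutation relation reads
      \<open>z * \<i> = - (\<i> * z)\<close>.\<close>
    then have "z = 0"
      unfolding oi_octv omult_octv octv_scaleR by (simp add: complex_eq_iff)
    then show ?thesis using zu by (simp add: T_def)
  qed
  have \<Phi>z: "\<Phi> (octv z 0) = octv z 0" for z
  proof -
    have "octv z 0 = Re z *\<^sub>R o1 + Im z *\<^sub>R oi"
      by (simp add: o1_octv oi_octv octv_scaleR octv_add complex_eq_iff)
    then show ?thesis by (simp add: blinfun.bilinear_simps G2_o1 G \<Phi>i)
  qed
  have Tadd: "T (v + u) = T v + T u" for v u
  proof -
    have "octv 0 (v + u) = octv 0 v + octv 0 u" by (simp add: octv_add)
    then show ?thesis by (simp add: T_def vpart_add blinfun.add_right)
  qed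
  have Tscale: "T (c *s v) = c *s T v" for c v
  proof -
    \<comment> \<open>Complex scalars act by left multiplication with elements
      \<open>octv c 0\<close>, which \<open>\<Phi>\<close> fixes; hence \<open>T\<close> is complex
      linear.\<close>
    have "octv 0 (c *s v) = octv c 0 \<cdot> octv 0 v" by (simp add: omult_octv)
    then have "octv 0 (T (c *s v)) = octv c 0 \<cdot> octv 0 (T v)"
      by (metis G2_mult[OF G] \<Phi>v \<Phi>z)
    then show ?thesis by (simp add: omult_octv)
  qed
  define A where "A = matrix T"
  have "Vector_Spaces.linear (*s) (*s) T"
    by unfold_locales (simp_all add: Tadd Tscale vec_eq_iff algebra_simps)
  then have TA: "T v = A *v v" for v
    by (simp add: A_def matrix_works)
  have \<Phi>: "\<Phi> (octv z v) = octv z (A *v v)" for z v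
  proof -
    have "\<Phi> (octv z v) = \<Phi> (octv z 0 + octv 0 v)" by (simp add: octv_add)
    also have "\<dots> = octv z (A *v v)"
      by (simp only: blinfun.add_right \<Phi>v \<Phi>z TA) (simp add: octv_add)
    finally show ?thesis .
  qed
  \<comment> \<open>In the image of a product of two vectors, the complex component shows that
    \<open>A\<close> preserves \<open>herm\<close>, the vector component that it commutes with
    \<open>ccross\<close>.\<close>
  have "octv (- herm v u) (A *v ccross v u) = octv (- herm (A *v v) (A *v u)) (ccross (A *v v) (A *v u))"
    for v u
    using G2_mult[OF G, of "octv 0 v" "octv 0 u"] by (simp add: omult_octv \<Phi>)
  then have H: "herm (A *v v) (A *v u) = herm v u"
    and C: "ccross (A *v v) (A *v u) = A *v ccross v u" for v u
    by simp_all
  have nth: "herm (axis r 1) v = cnj (v $ r)" for v r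
    by (simp add: herm_def axis_def if_distrib[of "\<lambda>t. t * _"] cong: if_cong)
  have "conj_transpose A *v (A *v u) = u" for u
    unfolding vec_eq_iff
  proof
    fix r
    have "cnj ((conj_transpose A *v (A *v u)) $ r) = cnj (u $ r)"
      using H[of "axis r 1" u] by (simp add: herm_adjoint nth)
    then show "(conj_transpose A *v (A *v u)) $ r = u $ r" by simp
  qed
  then have 1: "conj_transpose A ** A = mat 1"
    by (simp add: matrix_eq matrix_vector_mul_assoc)
  then have 2: "A ** conj_transpose A = mat 1"
    by (simp add: matrix_left_right_inverse)
  \<comment> \<open>With \<open>C\<close> and unitarity the cofactor identity says that
    \<open>cnj (det A)\<close> fixes every cross product; that of the first two axis vectors is
    nonzero.\<close>
  have "cnj (det A) *s ccross (axis 1 1) (axis 2 1) = ccross (axis 1 1) (axis 2 1)"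
    using ccross_conj_transpose[of A "axis 1 1" "axis 2 1"]
    by (simp add: C matrix_vector_mul_assoc 1)
  then have "cnj (det A) = 1"
    by (simp add: vec_eq_iff forall_3 ccross_def axis_def)
  then have "det A = 1"
    by (metis complex_cnj_cnj complex_cnj_one)
  then have "A \<in> SU3" by (simp add: SU3_def 1 2)
  moreover have "\<Phi> = K_map A"
    by (rule blinfun_eqI) (metis \<Phi> K_map_octv octv_parts)
  ultimately show thesis by (rule that)
qed

text \<open>The combination formed with column \<open>s\<close> of \<open>M\<close> is
  \<open>octv 0 (column s M)\<close>, so existence and uniqueness for the description in
  \<open>K_matrix\<close> both reduce to comparing columns.\<close>

lemma K_matrix_K_map: "K_matrix (K_map A) = A"
  unfolding K_matrix_def
proof (rule the_equality)
  have col: "(\<Sum>r\<in>UNIV. cscale oi (M $ r $ s) (basis_i $ r)) = octv 0 (column s M)" for M s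
    by (simp add: basis_i_octv cscale_oi_octv octv_sum)
      (simp add: vec_eq_iff column_def axis_def if_distrib[of "(*) _"] cong: if_cong)
  show "\<forall>s. K_map A (basis_i $ s) = (\<Sum>r\<in>UNIV. cscale oi (A $ r $ s) (basis_i $ r))"
    by (simp add: col K_map_basis)
  show "M = A" if "\<forall>s. K_map A (basis_i $ s) = (\<Sum>r\<in>UNIV. cscale oi (M $ r $ s) (basis_i $ r))" for M
    using that by (simp add: col K_map_basis) (simp add: vec_eq_iff column_def)
qed

text \<open>\<open>K_map\<close> inverts the identification of the stabilizer with
  \<open>SU3\<close>; injectivity of \<open>K_matrix\<close> holds because every stabilizer element
  is some \<open>K_map A\<close>.\<close>

lemma SU3_act_eq:
  assumes "A \<in> SU3"
  shows "SU3_act \<phi> A = \<phi> o\<^sub>L K_map A"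
proof -
  have "inj_on K_matrix K_stab"
    by (rule inj_onI) (metis K_stab_eq_K_map K_matrix_K_map)
  then have "the_inv_into K_stab K_matrix A = K_map A"
    using K_map_in_K_stab[OF assms] by (intro the_inv_into_f_eq) (auto simp: K_matrix_K_map)
  then show ?thesis by (simp add: SU3_act_def)
qed

section \<open>The trivialization\<close>

text \<open>Fibres of \<open>G2_proj\<close> are left cosets of the stabilizer: the inverse of
  \<open>q\<close> followed after \<open>\<phi>\<close> fixes \<open>oi\<close>.\<close>

lemma G2_factor:
  assumes "q \<in> G2" "\<phi> \<in> G2" "blinfun_apply \<phi> oi = q oi"
  obtains A where "A \<in> SU3" "\<phi> = q o\<^sub>L K_map A"
proof -
  obtain q' where q': "q' \<in> G2" "\<And>x. blinfun_apply q' (q x) = x" "\<And>x. blinfun_apply q (q' x) = x"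
    using G2_inverse[OF assms(1)] by metis
  have "q' o\<^sub>L \<phi> \<in> K_stab"
    by (simp add: K_stab_def G2_over_def G2_proj_def G2_comp assms q')
  then obtain A where A: "A \<in> SU3" "q' o\<^sub>L \<phi> = K_map A" by (rule K_stab_eq_K_map)
  have "\<phi> x = (q o\<^sub>L K_map A) x" for x
    by (simp add: A(2)[symmetric] q')
  then show thesis using A(1) by (intro that) (auto intro: blinfun_eqI)
qed

text \<open>Since \<open>og = oj \<cdot> oe\<close>, the product
  \<open>\<eta> \<cdot> \<zeta>\<close> in the third column is the image of the third basis vector,
  so all columns have one form.\<close>

lemma theta_mat_nth:
  assumes "\<phi> \<in> G2"
  shows "theta_mat Q \<xi> \<phi> $ r $ s = hcoeff \<xi> (\<phi> (basis_i $ s)) (Q \<xi> (basis_i $ r))"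
proof -
  have "\<phi> oj \<cdot> \<phi> oe = \<phi> og" by (simp add: og_def G2_mult assms)
  then have "\<forall>r s. theta_mat Q \<xi> \<phi> $ r $ s = hcoeff \<xi> (\<phi> (basis_i $ s)) (Q \<xi> (basis_i $ r))"
    by (simp add: theta_mat_def Let_def forall_3 basis_i_simps)
  then show ?thesis by blast
qed

text \<open>Pulled back by \<open>Q \<xi>\<close> to the base point \<open>oi\<close>, the
  coefficients become the coordinates of the columns of \<open>A\<close>.\<close>

lemma theta_mat_comp_K_map:
  assumes "Q \<xi> \<in> G2" "Q \<xi> oi = \<xi>" "A \<in> SU3"
  shows "theta_mat Q \<xi> (Q \<xi> o\<^sub>L K_map A) = A"
proof -
  have "theta_mat Q \<xi> (Q \<xi> o\<^sub>L K_map A) $ r $ s = A $ r $ s" for r s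
  proof -
    have "theta_mat Q \<xi> (Q \<xi> o\<^sub>L K_map A) $ r $ s
        = hcoeff (Q \<xi> oi) (Q \<xi> (K_map A (basis_i $ s))) (Q \<xi> (basis_i $ r))"
      using assms by (simp add: theta_mat_nth G2_comp K_map_in_G2)
    also have "\<dots> = A $ r $ s"
      by (simp add: G2_hcoeff assms(1) hcoeff_oi_basis K_map_basis) (simp add: column_def)
    finally show ?thesis .
  qed
  then show ?thesis by (simp add: vec_eq_iff)
qed

section \<open>Smoothness of the trivialization and of its inverse\<close>

lemma smooth_map_on_K_map: "smooth_map_on S K_map"
proof -
  \<comment> \<open>\<open>K_map\<close> is only affine in \<open>A\<close>: every value keeps the
    complex part, and \<open>K_map 0\<close> is the projection onto it.\<close>
  have "linear (\<lambda>A. K_map A - K_map 0)"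
  proof
    show "K_map (A + B) - K_map 0 = K_map A - K_map 0 + (K_map B - K_map 0)" for A B
      by (rule blinfun_eqI)
        (simp add: blinfun.bilinear_simps K_map_apply matrix_vector_mult_add_rdistrib algebra_simps octv_add)
    show "K_map (c *\<^sub>R A) - K_map 0 = c *\<^sub>R (K_map A - K_map 0)" for c A
    proof (rule blinfun_eqI)
      fix x
      have "octv z v - octv z 0 = octv 0 v" for z v
        by (simp add: octv_def)
      then show "(K_map (c *\<^sub>R A) - K_map 0) x = (c *\<^sub>R (K_map A - K_map 0)) x"
        by (simp add: blinfun.bilinear_simps K_map_apply octv_scaleR)
          (simp add: vec_eq_iff matrix_vector_mult_def scaleR_sum_right)
    qed
  qed
  then have "bounded_linear (\<lambda>A. K_map A - K_map 0)"
    by (simp add: linear_conv_bounded_linear)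
  then have "smooth_map_on S (\<lambda>A. (K_map A - K_map 0) + K_map 0)"
    by (intro smooth_map_on_add smooth_map_on_const smooth_map_on_bounded_linear)
  then show ?thesis by simp
qed

lemma bounded_linear_blinfun_eval: "bounded_linear (\<lambda>\<phi>. blinfun_apply \<phi> x)"
  by (rule bounded_bilinear.bounded_linear_left[OF bounded_bilinear_blinfun_apply])

lemma smooth_map_on_psi1:
  assumes "smooth_map_on U Q"
  shows "smooth_map_on (G2_over U) (psi1 Q)"
proof -
  let ?S = "G2_over U"
  note eval = smooth_map_on_bounded_linear[OF bounded_linear_blinfun_eval]
  \<comment> \<open>The bundle projection is the restriction of a linear evaluation map, so
    composition with a linear map covers this case.\<close>
  have "smooth_map_on ?S (\<lambda>\<phi>. Q (\<phi> oi))"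
    by (rule smooth_map_on_compose_bounded_linear[OF bounded_linear_blinfun_eval assms])
      (auto simp: G2_over_def G2_proj_def)
  note Q = smooth_map_on_linear_image[OF bounded_linear_blinfun_eval this]
  have "smooth_map_on ?S (\<lambda>\<phi>. theta_mat Q (blinfun_apply \<phi> oi) \<phi> $ r $ s)" for r s
  proof -
    have "smooth_map_on ?S (\<lambda>\<phi>. hcoeff (\<phi> oi) (\<phi> (basis_i $ s)) (Q (\<phi> oi) (basis_i $ r)))"
      unfolding hcoeff_def Jmap_def
      by (intro smooth_map_on_Complex smooth_map_on_bounded_bilinear[OF bounded_bilinear_inner]
          smooth_map_on_bounded_bilinear[OF bounded_bilinear_omult] eval Q)
    \<comment> \<open>The entries have the form of \<open>theta_mat_nth\<close> only for
      multiplicative \<open>\<phi>\<close>; agreement on \<open>?S\<close> is enough.\<close>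
    then show ?thesis
      by (subst smooth_map_on_cong) (auto simp: G2_over_def theta_mat_nth)
  qed
  then have "smooth_map_on ?S (\<lambda>\<phi>. theta_mat Q (blinfun_apply \<phi> oi) \<phi>)"
    by (intro smooth_map_on_vec_nth)
  then show ?thesis
    unfolding psi1_def[abs_def] G2_proj_def by (intro smooth_map_on_Pair eval)
qed

theorem proposition3p3:
  fixes Q :: "oct \<Rightarrow> oct \<Rightarrow>\<^sub>L oct"
  assumes Q_G2: "\<And>\<xi>. \<xi> \<in> U1 \<Longrightarrow> Q \<xi> \<in> G2"
    and Q_smooth: "smooth_map_on U1 Q"
    and Q_section: "\<And>\<xi>. \<xi> \<in> U1 \<Longrightarrow> Q \<xi> oi = \<xi>"
  shows "(\<forall>\<xi>\<in>U1. \<forall>\<phi>\<in>G2_over {\<xi>}. theta_mat Q \<xi> \<phi> \<in> SU3) \<and> local_trivialization U1 (psi1 Q)"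
proof -
  define h where "h p = Q (fst p) o\<^sub>L K_map (snd p)" for p
  \<comment> \<open>This one fact gives both the unitarity of \<open>theta_mat\<close> and the
    surjectivity of \<open>h\<close> onto \<open>G2_over U1\<close>.\<close>
  have factor: "\<exists>A\<in>SU3. \<phi> = h (\<xi>, A)" if "\<xi> \<in> U1" "\<phi> \<in> G2" "\<phi> oi = \<xi>" for \<xi> and \<phi> :: "oct \<Rightarrow>\<^sub>L oct"
    using G2_factor[OF Q_G2[OF that(1)] that(2)] that(3) Q_section[OF that(1)]
    unfolding h_def by auto
  have theta_h: "theta_mat Q \<xi> (h (\<xi>, A)) = A" if "\<xi> \<in> U1" "A \<in> SU3" for \<xi> A
    unfolding h_def using theta_mat_comp_K_map Q_G2 Q_section that by simp
  have h_oi: "h (\<xi>, A) oi = \<xi>" if "\<xi> \<in> U1" for \<xi> A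
    using that by (simp add: h_def K_map_oi Q_section)
  have h_in: "h p \<in> G2_over U1" if "p \<in> U1 \<times> SU3" for p
    using that by (auto simp: G2_over_def G2_proj_def h_oi) (simp add: h_def G2_comp Q_G2 K_map_in_G2)
  have psi_h: "psi1 Q (h p) = p" if "p \<in> U1 \<times> SU3" for p
    using that by (auto simp: psi1_def G2_proj_def h_oi theta_h)
  have over: "\<exists>p\<in>U1 \<times> SU3. \<phi> = h p" if "\<phi> \<in> G2_over U1" for \<phi>
    using that factor by (fastforce simp: G2_over_def G2_proj_def)
  have h_psi: "h (psi1 Q \<phi>) = \<phi>" "psi1 Q \<phi> \<in> U1 \<times> SU3" if "\<phi> \<in> G2_over U1" for \<phi>
    using over[OF that] psi_h by auto
  have "theta_mat Q \<xi> \<phi> \<in> SU3" if "\<xi> \<in> U1" "\<phi> \<in> G2_over {\<xi>}" for \<xi> \<phi>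
    using that factor[of \<xi> \<phi>] theta_h[of \<xi>] by (auto simp: G2_over_def G2_proj_def)
  moreover have "openin (top_of_set S6) U1"
    unfolding U1_def by (simp add: openin_delete)
  moreover have bij: "bij_betw (psi1 Q) (G2_over U1) (U1 \<times> SU3)"
    by (rule bij_betw_byWitness[where f' = h])
      (use h_psi psi_h h_in in \<open>blast+\<close>)
  moreover have "smooth_map_on (U1 \<times> SU3) (the_inv_into (G2_over U1) (psi1 Q))"
  proof -
    \<comment> \<open>The abstract inverse is identified with \<open>h\<close> just on
      \<open>U1 \<times> SU3\<close>, where smoothness is asserted.\<close>
    have "the_inv_into (G2_over U1) (psi1 Q) p = h p" if "p \<in> U1 \<times> SU3" for p
      using bij_betw_imp_inj_on[OF bij] psi_h[OF that] h_in[OF that] by (rule the_inv_into_f_eq)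
    moreover have "smooth_map_on (U1 \<times> SU3) h"
      unfolding h_def[abs_def]
      by (intro smooth_map_on_bounded_bilinear[OF bounded_bilinear_blinfun_compose]
          smooth_map_on_compose_bounded_linear[OF bounded_linear_fst Q_smooth]
          smooth_map_on_compose_bounded_linear[OF bounded_linear_snd smooth_map_on_K_map[of UNIV]])
        auto
    ultimately show ?thesis
      by (subst smooth_map_on_cong)
  qed
  moreover have "psi1 Q (SU3_act \<phi> B) = (fst (psi1 Q \<phi>), snd (psi1 Q \<phi>) ** B)"
    if \<phi>: "\<phi> \<in> G2_over U1" and B: "B \<in> SU3" for \<phi> B
  proof -
    obtain \<xi> A where p: "\<xi> \<in> U1" "A \<in> SU3" "\<phi> = h (\<xi>, A)"
      using over[OF \<phi>] by auto
    \<comment> \<open>Associativity of composition: the right action multiplies the matrix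
      coordinate on the right and leaves \<open>\<xi>\<close> alone.\<close>
    have "SU3_act \<phi> B = h (\<xi>, A ** B)"
      by (rule blinfun_eqI) (simp add: SU3_act_eq B p h_def K_map_mult)
    then show ?thesis
      using p B by (simp add: psi_h SU3_mult)
  qed
  moreover have "fst (psi1 Q \<phi>) = G2_proj \<phi>" for \<phi>
    by (simp add: psi1_def)
  ultimately show ?thesis
    unfolding local_trivialization_def diffeomorphism_betw_def
    using smooth_map_on_psi1[OF Q_smooth] by blast
qed

end
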